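(* Let $q,\alpha,z$ be nonzero complex numbers with $|q|<1$, $|zq|<1$, and such that $-zq^{k}\neq\alpha$ for all integers $k\ge 1$ and $zq^{2k+1}\neq\alpha$ for all integers $k\ge 0$. Then $$\sum_{m=1}^{\infty}\frac{(z^2q^2/\alpha;q^2)_{m-1}\,q^{2m}}{(-zq/\alpha;q)_{2m}(zq;q)_{2m}(-zq^{2m+2}/\alpha;q^2)_\infty(zq^{2m+2};q^2)_\infty} =\frac{q^2(z^2q^2/\alpha;q^2)_\infty}{(zq;q)_\infty(-zq/\alpha;q)_\infty}\,\omega_{1}(\alpha,z;q)+F(\alpha,z;q),$$ where $$F(\alpha,z;q)=\frac{1}{(-zq^2/\alpha;q^2)_\infty(zq^2;q^2)_\infty}\Bigg(\frac{q^2}{1+zq/\alpha}\sum_{m=0}^{\infty}\frac{(-\alpha/(zq);q^2)_{m+1}}{(-zq;q^2)_{m+1}}(zq)^m-\frac{\alpha q}{z}\,\frac{(z^2q^2/\alpha;q^2)_\infty}{(z^2q^2;q^4)_{\infty}(z^2q^2/\alpha^2;q^{4})_{\infty}}\sum_{n=0}^{\infty}\alpha^nq^{n^2+n}\Bigg).$$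
   Context: Notation: $(a;q)_n=\prod_{m=0}^{n-1}(1-aq^m)$, $(a;q)_0=1$, $(a;q)_\infty=\prod_{m=0}^{\infty}(1-aq^m)$ for $|q|<1$. Definition: $$\omega_{1}(\alpha,z;q)=\sum_{n=0}^{\infty}\frac{q^{2n}}{(-zq;q^2)_{n+1}(zq/\alpha;q^{2})_{n+1}}.$$ *)

theory Defs
  imports "HOL-Analysis.Analysis"
begin

definition qpoch :: "complex \<Rightarrow> complex \<Rightarrow> nat \<Rightarrow> complex" where
  "qpoch a q n = (\<Prod>m<n. 1 - a * q ^ m)"

text \<open>
  Intended for \<open>norm q < 1\<close>, where the product converges. The library's \<open>prodinf\<close> admits
  finitely many vanishing factors, in which case its value is \<open>0\<close>.
\<close>

definition qpoch_inf :: "complex \<Rightarrow> complex \<Rightarrow> complex" where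
  "qpoch_inf a q = prodinf (\<lambda>m. 1 - a * q ^ m)"

definition omega1 :: "complex \<Rightarrow> complex \<Rightarrow> complex \<Rightarrow> complex" where
  "omega1 \<alpha> z q =
     (\<Sum>n. q ^ (2 * n) / (qpoch (- z * q) (q ^ 2) (n + 1) * qpoch (z * q / \<alpha>) (q ^ 2) (n + 1)))"

definition F_rem :: "complex \<Rightarrow> complex \<Rightarrow> complex \<Rightarrow> complex" where
  "F_rem \<alpha> z q =
     1 / (qpoch_inf (- z * q ^ 2 / \<alpha>) (q ^ 2) * qpoch_inf (z * q ^ 2) (q ^ 2)) *
     (q ^ 2 / (1 + z * q / \<alpha>) *
        (\<Sum>m. qpoch (- \<alpha> / (z * q)) (q ^ 2) (m + 1) / qpoch (- z * q) (q ^ 2) (m + 1) * (z * q) ^ m)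
      - \<alpha> * q / z *
        (qpoch_inf (z ^ 2 * q ^ 2 / \<alpha>) (q ^ 2) /
          (qpoch_inf (z ^ 2 * q ^ 2) (q ^ 4) * qpoch_inf (z ^ 2 * q ^ 2 / \<alpha> ^ 2) (q ^ 4))) *
        (\<Sum>n. \<alpha> ^ n * q ^ (n ^ 2 + n)))"

end

theory Submission
  imports Defs
begin

text \<open>
  Put \<open>p = q\<^sup>2\<close>, \<open>x = z q\<close>, \<open>y = z q / \<alpha>\<close>, and write \<open>(a)\<^sub>n\<close> for the \<open>p\<close>-shifted factorial.
  Multiplying by the two infinite products that the denominators on the left complete to,
  and dividing by \<open>p\<close>, turns the claim into a relation between
  \<open>L = \<Sum> (x y)\<^sub>n p^n / ((-y)\<^sub>n\<^sub>+\<^sub>1 (x)\<^sub>n\<^sub>+\<^sub>1)\<close> and \<open>\<omega>\<^sub>1 = \<Sum> p^n / ((y)\<^sub>n\<^sub>+\<^sub>1 (-x)\<^sub>n\<^sub>+\<^sub>1)\<close>. Both are values of one function,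

  \<open>S(x, y, u) = \<Sum> (u y)\<^sub>n p^n / ((y)\<^sub>n\<^sub>+\<^sub>1 (x)\<^sub>n\<^sub>+\<^sub>1)\<close>,

  namely \<open>L = S(x, -y, -x)\<close> and \<open>\<omega>\<^sub>1 = S(-x, y, 0)\<close>.

  Lemma \<open>three_term_transformation\<close> writes \<open>S(x, y, u)\<close> as an infinite product times the series
  \<open>\<Sum> \<Prod>(u - x p^k / y)\<close>, the \<open>N\<close>-th product being over \<open>k = 1, \<dots>, N\<close>, minus
  \<open>1 / y\<close> times Fine's series \<open>\<Sum> (p / y)\<^sub>m x^m / (u)\<^sub>m\<^sub>+\<^sub>1\<close>. For \<open>L\<close> the first series is
  \<open>V = \<Sum> (p / y)\<^sub>m (-x)^m\<close> and the second is, up to a constant factor, the first series in \<open>F\<close>. For \<open>\<omega>\<^sub>1\<close> the first series is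
  the partial theta function in \<open>F\<close> and the second is again \<open>V\<close>, because \<open>u = 0\<close> removes the
  denominator. Eliminating \<open>V\<close> between the two evaluations is the theorem.

  The transformation holds because \<open>S\<close> and Fine's series, as functions of \<open>x\<close>, satisfy equations
  \<open>(1 - x) f(x) = g(x) + (u - c x) f(x p)\<close> with the same \<open>u\<close> and the same \<open>c = p / y\<close>. Such an
  equation has only one solution that stays bounded along \<open>x p^n\<close>, and iterating it gives that
  solution as a series (\<open>iterate_q_difference_equation\<close>). For \<open>S\<close> the inhomogeneity
  \<open>g\<close> is an infinite product minus \<open>1\<close>, up to the factor \<open>1 / y\<close>; for Fine's series it is \<open>1\<close>.
  The \<open>-1\<close> in the former therefore contributes exactly \<open>-1 / y\<close> times Fine's series.
\<close>

section \<open>Finite and infinite $q$-shifted factorials\<close>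

lemma qpoch_0 [simp]: "qpoch a q 0 = 1"
  by (simp add: qpoch_def)

lemma qpoch_Suc: "qpoch a q (Suc n) = qpoch a q n * (1 - a * q ^ n)"
  by (simp add: qpoch_def)

lemma qpoch_add: "qpoch a q (n + m) = qpoch a q n * qpoch (a * q ^ n) q m"
  by (induction m) (simp_all add: qpoch_Suc power_add mult.assoc)

lemma qpoch_Suc_left: "qpoch a q (Suc n) = (1 - a) * qpoch (a * q) q n"
  using qpoch_add[of a q 1 n] by (simp add: qpoch_def)

lemma qpoch_nonzero:
  assumes "\<And>k. a * q ^ k \<noteq> 1"
  shows "qpoch a q n \<noteq> 0"
  using assms by (auto simp: qpoch_def)

lemma norm_mult_power_le:
  fixes x q :: complex
  assumes "norm q < 1"
  shows "norm (x * q ^ k) \<le> norm x"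
proof -
  have "norm x * norm q ^ k \<le> norm x * 1"
    by (intro mult_left_mono power_le_one) (use assms in auto)
  thus ?thesis by (simp add: norm_mult norm_power)
qed

lemma mult_power_neq_1:
  fixes x q :: complex
  assumes "norm q < 1" "norm x < 1"
  shows "x * q ^ k \<noteq> 1"
  using norm_mult_power_le[OF assms(1), of x k] assms(2) by auto

lemma convergent_prod_qpoch:
  fixes a q :: complex
  assumes "norm q < 1"
  shows "convergent_prod (\<lambda>m. 1 - a * q ^ m)"
proof -
  have "summable (\<lambda>m. norm (- a * q ^ m))"
    using assms by (simp add: norm_mult norm_power summable_mult)
  hence "abs_convergent_prod (\<lambda>m. 1 - a * q ^ m)"
    by (intro summable_imp_abs_convergent_prod) simp
  thus ?thesis
    by (rule abs_convergent_prod_imp_convergent_prod)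
qed

lemma qpoch_LIMSEQ:
  assumes "norm q < 1"
  shows "qpoch a q \<longlonglongrightarrow> qpoch_inf a q"
proof -
  have "(\<lambda>n. \<Prod>m\<le>n. 1 - a * q ^ m) \<longlonglongrightarrow> qpoch_inf a q"
    unfolding qpoch_inf_def by (rule convergent_prod_LIMSEQ[OF convergent_prod_qpoch[OF assms]])
  hence "(\<lambda>n. qpoch a q (Suc n)) \<longlonglongrightarrow> qpoch_inf a q"
    by (simp add: qpoch_def lessThan_Suc_atMost)
  thus ?thesis by (simp only: filterlim_sequentially_Suc)
qed

lemma qpoch_inf_nonzero:
  assumes "norm q < 1" "\<And>k. a * q ^ k \<noteq> 1"
  shows "qpoch_inf a q \<noteq> 0"
  unfolding qpoch_inf_def
  by (rule prodinf_nonzero[OF convergent_prod_qpoch[OF assms(1)]]) (use assms(2) in auto)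

lemma qpoch_inf_split:
  assumes "norm q < 1"
  shows "qpoch_inf a q = qpoch a q n * qpoch_inf (a * q ^ n) q"
proof (rule LIMSEQ_unique)
  show "(\<lambda>m. qpoch a q (n + m)) \<longlonglongrightarrow> qpoch_inf a q"
    using LIMSEQ_ignore_initial_segment[OF qpoch_LIMSEQ[OF assms], of a n]
    by (simp add: add.commute)
  show "(\<lambda>m. qpoch a q (n + m)) \<longlonglongrightarrow> qpoch a q n * qpoch_inf (a * q ^ n) q"
    unfolding qpoch_add by (intro tendsto_mult tendsto_const qpoch_LIMSEQ assms)
qed

lemma qpoch_even: "qpoch a q (2 * n) = qpoch a (q ^ 2) n * qpoch (a * q) (q ^ 2) n"
  by (induction n)
     (simp_all add: qpoch_Suc power_mult [symmetric] mult.assoc mult.left_commute mult.commute)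

lemma norm_power2_less_1: "norm (q ^ 2) < 1" if "norm q < 1" for q :: complex
  using that by (simp add: norm_power power_less_one_iff abs_square_less_1)

lemma qpoch_inf_even_odd:
  assumes "norm q < 1"
  shows "qpoch_inf a q = qpoch_inf a (q ^ 2) * qpoch_inf (a * q) (q ^ 2)"
proof (rule LIMSEQ_unique)
  show "(\<lambda>n. qpoch a q (2 * n)) \<longlonglongrightarrow> qpoch_inf a q"
    using LIMSEQ_subseq_LIMSEQ[OF qpoch_LIMSEQ[OF assms], of "\<lambda>n. 2 * n" a]
    by (simp add: strict_mono_def o_def)
  show "(\<lambda>n. qpoch a q (2 * n)) \<longlonglongrightarrow> qpoch_inf a (q ^ 2) * qpoch_inf (a * q) (q ^ 2)"
    unfolding qpoch_even by (intro tendsto_mult qpoch_LIMSEQ norm_power2_less_1 assms)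
qed

lemma qpoch_inf_difference_of_squares:
  assumes "norm q < 1"
  shows "qpoch_inf (a ^ 2) (q ^ 2) = qpoch_inf a q * qpoch_inf (- a) q"
proof (rule LIMSEQ_unique)
  show "qpoch (a ^ 2) (q ^ 2) \<longlonglongrightarrow> qpoch_inf (a ^ 2) (q ^ 2)"
    by (intro qpoch_LIMSEQ norm_power2_less_1 assms)
  have "qpoch (a ^ 2) (q ^ 2) n = qpoch a q n * qpoch (- a) q n" for n
    by (induction n) (simp_all add: qpoch_Suc algebra_simps power2_eq_square power_mult_distrib)
  moreover have "(\<lambda>n. qpoch a q n * qpoch (- a) q n) \<longlonglongrightarrow> qpoch_inf a q * qpoch_inf (- a) q"
    by (intro tendsto_mult qpoch_LIMSEQ assms)
  ultimately show "qpoch (a ^ 2) (q ^ 2) \<longlonglongrightarrow> qpoch_inf a q * qpoch_inf (- a) q"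
    by (simp add: LIMSEQ_def)
qed

lemma Bseq_qpoch: "norm q < 1 \<Longrightarrow> Bseq (qpoch a q)"
  by (rule convergent_imp_Bseq[OF convergentI[OF qpoch_LIMSEQ]])

lemma Bseq_inverse_qpoch:
  assumes "norm q < 1" "\<And>k. a * q ^ k \<noteq> 1"
  shows "Bseq (\<lambda>n. inverse (qpoch a q n))"
  by (rule convergent_imp_Bseq[OF convergentI])
     (rule tendsto_inverse[OF qpoch_LIMSEQ[OF assms(1)] qpoch_inf_nonzero[OF assms]])

lemma qpoch_bounds:
  assumes "norm q < 1"
  obtains C where "C > 0" "\<And>n. norm (qpoch a q n) \<le> C"
  using Bseq_qpoch[OF assms, of a] by (auto simp: Bseq_def)

lemma inverse_qpoch_bounds:
  assumes "norm q < 1" "\<And>k. a * q ^ k \<noteq> 1"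
  obtains C where "C > 0" "\<And>n. norm (inverse (qpoch a q n)) \<le> C"
  using Bseq_inverse_qpoch[OF assms] by (auto simp: Bseq_def)


section \<open>A first-order $q$-difference equation\<close>

text \<open>
  Besides convergence this records a bound that depends only on \<open>C\<close> and \<open>r\<close>, so that it is
  uniform along a sequence of points \<open>w\<close> or of coefficient families.
\<close>

lemma power_series_bounded_coeffs:
  fixes a :: "nat \<Rightarrow> complex"
  assumes "\<And>m. norm (a m) \<le> C" "norm w \<le> r" "r < 1"
  shows "summable (\<lambda>m. a m * w ^ m)" "norm (\<Sum>m. a m * w ^ m) \<le> C / (1 - r)"
proof -
  have r: "r \<ge> 0" using norm_ge_zero assms(2) by (rule order_trans)
  have le: "norm (a m * w ^ m) \<le> C * r ^ m" for m
    unfolding norm_mult norm_power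
    by (intro mult_mono power_mono assms order_trans[OF norm_ge_zero assms(1)]) auto
  have sums: "(\<lambda>m. C * r ^ m) sums (C * (1 / (1 - r)))"
    by (intro sums_mult geometric_sums) (use r assms in auto)
  hence sm: "summable (\<lambda>m. C * r ^ m)" by (rule sums_summable)
  have sn: "summable (\<lambda>m. norm (a m * w ^ m))"
    by (rule summable_comparison_test'[OF sm]) (use le in auto)
  thus "summable (\<lambda>m. a m * w ^ m)" by (rule summable_norm_cancel)
  have "norm (\<Sum>m. a m * w ^ m) \<le> (\<Sum>m. norm (a m * w ^ m))"
    by (rule summable_norm[OF sn])
  also have "\<dots> \<le> (\<Sum>m. C * r ^ m)" by (rule suminf_le[OF le sn sm])
  also have "\<dots> = C / (1 - r)" using sums by (simp add: sums_iff)
  finally show "norm (\<Sum>m. a m * w ^ m) \<le> C / (1 - r)" .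
qed

text \<open>
  The ratio of consecutive terms tends to \<open>u\<close>, which lies inside the unit disc.
\<close>

lemma summable_prod_limit_small:
  fixes u b q :: complex
  assumes "norm q < 1" "norm u < 1"
  shows "summable (\<lambda>N. \<Prod>k<N. u - b * q ^ k)"
proof -
  define r where "r = (1 + norm u) / 2"
  have r: "norm u < r" "r < 1" using assms(2) by (simp_all add: r_def)
  have "(\<lambda>k. u - b * q ^ k) \<longlonglongrightarrow> u - b * 0"
    by (intro tendsto_diff tendsto_mult tendsto_const LIMSEQ_power_zero assms)
  hence "(\<lambda>k. norm (u - b * q ^ k)) \<longlonglongrightarrow> norm (u - b * 0)" by (rule tendsto_norm)
  hence "eventually (\<lambda>k. norm (u - b * q ^ k) < r) sequentially"
    using r by (intro order_tendstoD) auto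
  then obtain K where K: "\<And>k. k \<ge> K \<Longrightarrow> norm (u - b * q ^ k) < r"
    by (auto simp: eventually_sequentially)
  show ?thesis
  proof (rule summable_ratio_test[OF r(2)])
    fix n assume "n \<ge> K"
    thus "norm (\<Prod>k<Suc n. u - b * q ^ k) \<le> r * norm (\<Prod>k<n. u - b * q ^ k)"
      using K[of n] by (simp add: norm_mult mult.commute mult_right_mono)
  qed
qed

text \<open>
  Here \<open>f n\<close> and \<open>g n\<close> stand for the values at \<open>x q^n\<close> of functions with
  \<open>(1 - w) f(w) = g(w) + (u - c w) f(w q)\<close>, where \<open>b = c x\<close>. Substituting the equation into
  itself \<open>N\<close> times leaves the remainder \<open>f N / (x; q)\<^sub>N\<close> times a product that tends to \<open>0\<close>. The
  denominators converge to a nonzero limit, so the remainder vanishes when \<open>f\<close> is bounded.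
\<close>

lemma iterate_q_difference_equation:
  fixes f g :: "nat \<Rightarrow> complex"
  assumes q: "norm q < 1" and x: "norm x < 1" and u: "norm u < 1" and f: "Bseq f"
    and eq: "\<And>n. (1 - x * q ^ n) * f n = g n + (u - b * q ^ n) * f (Suc n)"
  shows "(\<lambda>N. g N * (\<Prod>k<N. u - b * q ^ k) / qpoch x q (Suc N)) sums f 0"
proof -
  define P where "P = (\<lambda>N. \<Prod>k<N. u - b * q ^ k)"
  have x1: "x * q ^ k \<noteq> 1" for k by (rule mult_power_neq_1[OF q x])
  have nz: "qpoch x q n \<noteq> 0" for n by (rule qpoch_nonzero[OF x1])
  have "P N * f N * inverse (qpoch x q N) = f 0 - (\<Sum>n<N. g n * P n / qpoch x q (Suc n))" for N
  proof (induction N)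
    case (Suc N)
    have step: "P (Suc N) * f (Suc N) = P N * ((1 - x * q ^ N) * f N - g N)"
      by (simp add: eq P_def)
    have cancel: "A * (s * F - G) * inverse (Q * s) = A * F * inverse Q - G * A / (Q * s)"
      if "s \<noteq> 0" "Q \<noteq> 0" for A s F G Q :: complex
      using that by (simp add: field_simps)
    have "P (Suc N) * f (Suc N) * inverse (qpoch x q (Suc N)) =
        P N * f N * inverse (qpoch x q N) - g N * P N / qpoch x q (Suc N)"
      unfolding step qpoch_Suc by (rule cancel) (use x1[of N] nz[of N] in auto)
    thus ?case using Suc.IH by simp
  qed (simp add: P_def)
  hence partial: "(\<Sum>n<N. g n * P n / qpoch x q (Suc n)) =
      f 0 - P N * (f N * inverse (qpoch x q N))" for N
    by (simp add: algebra_simps)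
  have "P \<longlonglongrightarrow> 0"
    unfolding P_def by (rule summable_LIMSEQ_zero[OF summable_prod_limit_small[OF q u]])
  moreover have "Bseq (\<lambda>N. f N * inverse (qpoch x q N))"
    by (rule Bseq_mult[OF f Bseq_inverse_qpoch[OF q x1]])
  ultimately have "(\<lambda>N. P N * (f N * inverse (qpoch x q N))) \<longlonglongrightarrow> 0"
    using bounded_bilinear.Zfun_prod_Bfun[OF bounded_bilinear_mult]
    by (simp add: tendsto_Zfun_iff)
  hence "(\<lambda>N. f 0 - P N * (f N * inverse (qpoch x q N))) \<longlonglongrightarrow> f 0 - 0"
    by (intro tendsto_diff tendsto_const)
  thus ?thesis unfolding sums_def partial[unfolded P_def] by (simp add: P_def)
qed


section \<open>Fine's series and a three-term transformation\<close>

lemma Fine_coeffs_bounded: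
  assumes q: "norm q < 1" and u: "norm u < 1"
  obtains C where "\<And>m. norm (qpoch c q m / qpoch u q (Suc m)) \<le> C"
proof -
  obtain C where C: "C > 0" "\<And>n. norm (qpoch c q n) \<le> C"
    using qpoch_bounds[OF q, of c] by blast
  obtain D where D: "D > 0" "\<And>n. norm (inverse (qpoch u q n)) \<le> D"
    using inverse_qpoch_bounds[OF q mult_power_neq_1[OF q u]] by blast
  have "norm (qpoch c q m / qpoch u q (Suc m)) \<le> C * D" for m
    unfolding divide_inverse norm_mult by (intro mult_mono C D) (use C in auto)
  thus ?thesis by (rule that)
qed

lemma Fine_series_summable:
  assumes "norm q < 1" "norm x < 1" "norm u < 1"
  shows "summable (\<lambda>m. qpoch c q m * x ^ m / qpoch u q (Suc m))"
proof -
  obtain C where "\<And>m. norm (qpoch c q m / qpoch u q (Suc m)) \<le> C"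
    using Fine_coeffs_bounded[OF assms(1,3), of c] by blast
  from power_series_bounded_coeffs(1)[OF this order_refl assms(2)] show ?thesis
    by simp
qed

text \<open>
  For Fine's function \<open>f(w) = \<Sum> (c)\<^sub>m w^m / (u)\<^sub>m\<^sub>+\<^sub>1\<close>, combining the terms of \<open>f(w) - u f(w q)\<close>
  cancels the last factor of the denominator and gives \<open>e m = (c)\<^sub>m w^m / (u)\<^sub>m\<close>, while combining
  those of \<open>w f(w) - c w f(w q)\<close> appends a factor to the numerator and gives \<open>e (m + 1)\<close>. The two
  sums differ by \<open>e 0 = 1\<close>, which is the \<open>q\<close>-difference equation with \<open>g = 1\<close>.
\<close>

lemma Fine_series_sums:
  assumes q: "norm q < 1" and x: "norm x < 1" and u: "norm u < 1"
  shows "(\<lambda>N. (\<Prod>k<N. u - c * x * q ^ k) / qpoch x q (Suc N)) sums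
         (\<Sum>m. qpoch c q m * x ^ m / qpoch u q (Suc m))"
proof -
  define a where "a = (\<lambda>m. qpoch c q m / qpoch u q (Suc m))"
  define f where "f = (\<lambda>w. \<Sum>m. a m * w ^ m)"
  have u1: "u * q ^ k \<noteq> 1" for k by (rule mult_power_neq_1[OF q u])
  have nz: "qpoch u q n \<noteq> 0" for n by (rule qpoch_nonzero[OF u1])
  obtain C where C: "\<And>m. norm (a m) \<le> C"
    using Fine_coeffs_bounded[OF q u, of c] unfolding a_def by blast
  have sm: "summable (\<lambda>m. a m * w ^ m)" if "norm w < 1" for w
    by (rule power_series_bounded_coeffs(1)[OF C order_refl that])
  have "Bseq (\<lambda>n. f (x * q ^ n))"
    unfolding f_def
    by (rule BseqI', rule power_series_bounded_coeffs(2)[OF C norm_mult_power_le[OF q] x])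
  moreover have "(1 - w) * f w = 1 + (u - c * w) * f (w * q)" if w: "norm w < 1" for w
  proof -
    have wq: "norm (w * q) < 1" using norm_mult_power_le[OF q, of w 1] w by simp
    have sums1: "(\<lambda>m. a m * w ^ m) sums f w" 
      and sums2: "(\<lambda>m. a m * (w * q) ^ m) sums f (w * q)"
      unfolding f_def by (rule summable_sums[OF sm[OF w]] summable_sums[OF sm[OF wq]])+
    define e where "e = (\<lambda>m. qpoch c q m * w ^ m / qpoch u q m)"
    have e: "a m * w ^ m - u * (a m * (w * q) ^ m) = e m" for m
    proof -
      have "a m * w ^ m - u * (a m * (w * q) ^ m) = a m * (1 - u * q ^ m) * w ^ m"
        by (simp add: power_mult_distrib algebra_simps)
      also have "a m * (1 - u * q ^ m) = qpoch c q m / qpoch u q m"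
        using u1[of m] by (simp add: a_def qpoch_Suc)
      finally show ?thesis by (simp add: e_def)
    qed
    have e_Suc: "w * (a m * w ^ m) - c * w * (a m * (w * q) ^ m) = e (Suc m)" for m
      by (simp add: a_def e_def qpoch_Suc[of c] power_mult_distrib diff_divide_distrib algebra_simps)
    have "e sums (f w - u * f (w * q))"
      using sums_diff[OF sums1 sums_mult[OF sums2, of u]] unfolding e .
    moreover have "(\<lambda>m. e (Suc m)) sums (w * f w - c * w * f (w * q))"
      using sums_diff[OF sums_mult[OF sums1, of w] sums_mult[OF sums2, of "c * w"]] unfolding e_Suc .
    hence "e sums (w * f w - c * w * f (w * q) + e 0)" by (rule sums_Suc)
    ultimately have "f w - u * f (w * q) = w * f w - c * w * f (w * q) + e 0"
      by (rule sums_unique2)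
    moreover have "e 0 = 1" by (simp add: e_def)
    ultimately show ?thesis by (simp add: algebra_simps)
  qed
  hence "(1 - x * q ^ n) * f (x * q ^ n) = 1 + (u - c * x * q ^ n) * f (x * q ^ Suc n)" for n
    using order_le_less_trans[OF norm_mult_power_le[OF q] x] by (simp add: ac_simps)
  ultimately have "(\<lambda>N. 1 * (\<Prod>k<N. u - c * x * q ^ k) / qpoch x q (Suc N)) sums f (x * q ^ 0)"
    by (rule iterate_q_difference_equation[OF q x u])
  thus ?thesis by (simp add: f_def a_def)
qed

text \<open>
  The difference equation for the left-hand side comes from telescoping. With \<open>b = u y\<close> and
  \<open>r n = (b)\<^sub>n / ((y)\<^sub>n (w q)\<^sub>n)\<close>, the difference \<open>r (n + 1) - r n\<close> is a combination of the terms of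
  the series at \<open>w\<close> and at \<open>w q\<close>, so that \<open>g(w) = (lim r - 1) / y\<close>. In the iterated series
  the product \<open>(x q\<^sup>N\<^sup>+\<^sup>1; q)\<^sub>\<infinity>\<close> in \<open>lim r\<close> completes \<open>(x; q)\<^sub>N\<^sub>+\<^sub>1\<close> to \<open>(x; q)\<^sub>\<infinity>\<close>, which makes that
  part of \<open>g\<close> contribute a constant multiple of \<open>\<Sum> \<Prod>(u - c x q^k)\<close>, and the part \<open>-1 / y\<close>
  contributes Fine's series.
\<close>

lemma three_term_transformation:
  assumes q: "norm q < 1" and x: "norm x < 1" and u: "norm u < 1"
    and y: "y \<noteq> 0" "\<And>k. y * q ^ k \<noteq> 1"
  shows "(\<lambda>n. qpoch (u * y) q n * q ^ n / (qpoch y q (Suc n) * qpoch x q (Suc n))) sums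
    (qpoch_inf (u * y) q / (y * qpoch_inf y q * qpoch_inf x q)
        * (\<Sum>N. \<Prod>k<N. u - x * q / y * q ^ k)
      - 1 / y * (\<Sum>m. qpoch (q / y) q m * x ^ m / qpoch u q (Suc m)))"
proof -
  define b where "b = u * y"
  define c where "c = q / y"
  define t where "t = (\<lambda>w n. qpoch b q n / (qpoch y q (Suc n) * qpoch w q (Suc n)) * q ^ n)"
  define S where "S = (\<lambda>w. \<Sum>n. t w n)"
  define g where "g = (\<lambda>w. (qpoch_inf b q / (qpoch_inf y q * qpoch_inf (w * q) q) - 1) / y)"
  have x1: "x * q ^ k \<noteq> 1" for k by (rule mult_power_neq_1[OF q x])
  have xq: "norm (x * q ^ k) < 1" for k
    by (rule order_le_less_trans[OF norm_mult_power_le[OF q] x])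
  have nzy: "qpoch y q n \<noteq> 0" for n by (rule qpoch_nonzero[OF y(2)])
  have nzx: "qpoch x q n \<noteq> 0" for n by (rule qpoch_nonzero[OF x1])
  obtain B where B: "B > 0" "\<And>n. norm (qpoch b q n) \<le> B" using qpoch_bounds[OF q, of b] by blast
  obtain Y where Y: "Y > 0" "\<And>n. norm (inverse (qpoch y q n)) \<le> Y"
    using inverse_qpoch_bounds[OF q y(2)] by blast
  obtain X where X: "X > 0" "\<And>n. norm (qpoch x q n) \<le> X" using qpoch_bounds[OF q, of x] by blast
  obtain X' where X': "X' > 0" "\<And>n. norm (inverse (qpoch x q n)) \<le> X'"
    using inverse_qpoch_bounds[OF q x1] by blast
  \<comment> \<open>Boundedness along \<open>x q^k\<close> needs a bound that does not depend on \<open>k\<close>.\<close>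
  have inv_le: "norm (inverse (qpoch (x * q ^ k) q n)) \<le> X * X'" for k n
  proof -
    have "inverse (qpoch (x * q ^ k) q n) = qpoch x q k * inverse (qpoch x q (k + n))"
      using nzx[of k] by (simp add: qpoch_add field_simps)
    thus ?thesis using X X' by (simp add: norm_mult mult_mono)
  qed
  have t_le: "norm (qpoch b q n / (qpoch y q (Suc n) * qpoch (x * q ^ k) q (Suc n)))
      \<le> B * (Y * (X * X'))" for k n
    unfolding divide_inverse inverse_mult_distrib norm_mult
    by (intro mult_mono B Y inv_le) (use B Y X X' in auto)
  have S_sums: "t (x * q ^ k) sums S (x * q ^ k)" for k
    unfolding S_def t_def
    by (rule summable_sums, rule power_series_bounded_coeffs(1)[OF t_le order_refl q])
  have "Bseq (\<lambda>k. S (x * q ^ k))"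
    unfolding S_def t_def
    by (rule BseqI', rule power_series_bounded_coeffs(2)[OF t_le order_refl q])
  moreover have "(1 - x * q ^ k) * S (x * q ^ k) =
      g (x * q ^ k) + (u - c * x * q ^ k) * S (x * q ^ Suc k)" for k
  proof -
    define w where "w = x * q ^ k"
    have wq: "w * q = x * q ^ Suc k" by (simp add: w_def)
    have w1: "w * q * q ^ j \<noteq> 1" for j unfolding wq by (rule mult_power_neq_1[OF q xq])
    have nzw: "qpoch (w * q) q n \<noteq> 0" for n by (rule qpoch_nonzero[OF w1])
    have w0: "w \<noteq> 1" using xq[of k] by (auto simp: w_def)
    define r where "r = (\<lambda>n. qpoch b q n / (qpoch y q n * qpoch (w * q) q n))"
    have "r \<longlonglongrightarrow> qpoch_inf b q / (qpoch_inf y q * qpoch_inf (w * q) q)"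
      unfolding r_def
      by (intro tendsto_divide tendsto_mult qpoch_LIMSEQ q)
         (simp add: qpoch_inf_nonzero[OF q y(2)] qpoch_inf_nonzero[OF q w1])
    from sums_divide[OF telescope_sums[OF this], of y]
    have r_sums: "(\<lambda>n. (r (Suc n) - r n) / y) sums g w" by (simp add: g_def r_def)
    have "(1 - w) * t w n = (r (Suc n) - r n) / y + (u - c * w) * t (w * q) n" for n
    proof -
      define A where "A = qpoch b q n / (qpoch y q (Suc n) * qpoch (w * q) q (Suc n))"
      have y0: "1 - y * q ^ n \<noteq> 0" using y(2)[of n] by simp
      have w0': "1 - w * q * q ^ n \<noteq> 0" using w1[of n] by simp
      have A1: "(1 - w) * t w n = A * q ^ n * (1 - w * q * q ^ n)"
        using w0 w0' nzw[of n] nzy[of n] y0 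
        by (simp add: t_def A_def qpoch_Suc_left[of w] qpoch_Suc[of "w * q"])
      have A2: "r (Suc n) = A * (1 - b * q ^ n)"
        by (simp add: r_def A_def qpoch_Suc[of b])
      have A3: "r n = A * ((1 - y * q ^ n) * (1 - w * q * q ^ n))"
        using w0' nzw[of n] nzy[of n] y0 by (simp add: r_def A_def qpoch_Suc)
      have A4: "t (w * q) n = A * q ^ n" by (simp add: t_def A_def)
      show ?thesis unfolding A1 A2 A3 A4 
        using y(1) by (simp add: b_def c_def field_simps)
    qed
    with sums_mult[OF S_sums[of k], of "1 - w"]
    have "(\<lambda>n. (r (Suc n) - r n) / y + (u - c * w) * t (w * q) n) sums ((1 - w) * S w)"
      by (simp add: w_def)
    moreover have "(\<lambda>n. (r (Suc n) - r n) / y + (u - c * w) * t (w * q) n) sums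
        (g w + (u - c * w) * S (w * q))"
      using S_sums[of "Suc k"] unfolding wq[symmetric] by (intro sums_add r_sums sums_mult)
    ultimately have "(1 - w) * S w = g w + (u - c * w) * S (w * q)" by (rule sums_unique2)
    thus ?thesis by (simp add: w_def ac_simps)
  qed
  ultimately have "(\<lambda>N. g (x * q ^ N) * (\<Prod>k<N. u - c * x * q ^ k) / qpoch x q (Suc N)) sums
      S (x * q ^ 0)"
    by (rule iterate_q_difference_equation[OF q x u])
  hence main: "(\<lambda>N. g (x * q ^ N) * (\<Prod>k<N. u - c * x * q ^ k) / qpoch x q (Suc N)) sums S x"
    by simp
  define R where "R = qpoch_inf b q / (y * qpoch_inf y q * qpoch_inf x q)"
  have g_eq: "g (x * q ^ N) * p / qpoch x q (Suc N) = R * p - 1 / y * (p / qpoch x q (Suc N))"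
    for N p
  proof -
    have s: "qpoch_inf x q = qpoch x q (Suc N) * qpoch_inf (x * q ^ Suc N) q"
      by (rule qpoch_inf_split[OF q])
    have "qpoch_inf (x * q ^ Suc N) q \<noteq> 0"
      using s qpoch_inf_nonzero[OF q x1] by auto
    thus ?thesis using nzx[of "Suc N"] y(1) qpoch_inf_nonzero[OF q y(2)]
      unfolding R_def g_def s by (simp add: field_simps)
  qed
  have "(\<lambda>N. R * (\<Prod>k<N. u - c * x * q ^ k)
        - 1 / y * ((\<Prod>k<N. u - c * x * q ^ k) / qpoch x q (Suc N))) sums
      (R * (\<Sum>N. \<Prod>k<N. u - c * x * q ^ k)
        - 1 / y * (\<Sum>m. qpoch c q m * x ^ m / qpoch u q (Suc m)))"
    by (intro sums_diff sums_mult Fine_series_sums[OF q x u]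
          summable_sums[OF summable_prod_limit_small[OF q u]])
  with main have "S x = R * (\<Sum>N. \<Prod>k<N. u - c * x * q ^ k)
        - 1 / y * (\<Sum>m. qpoch c q m * x ^ m / qpoch u q (Suc m))"
    unfolding g_eq by (rule sums_unique2)
  with S_sums[of 0] show ?thesis
    by (simp add: t_def R_def b_def c_def ac_simps)
qed


section \<open>The identity for \<open>\<omega>\<^sub>1\<close>\<close>

(* The series on the left, indexed from m = 1 in print, is written with m + 1 for m = 0, 1, .... *)
theorem theorem1p2:
  fixes q \<alpha> z :: complex
  assumes "q \<noteq> 0" and "\<alpha> \<noteq> 0" and "z \<noteq> 0"
    and "norm q < 1" and "norm (z * q) < 1"
    and "\<And>k::nat. k \<ge> 1 \<Longrightarrow> - z * q ^ k \<noteq> \<alpha>"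
    and "\<And>k::nat. z * q ^ (2 * k + 1) \<noteq> \<alpha>"
  shows "(\<Sum>m. qpoch (z ^ 2 * q ^ 2 / \<alpha>) (q ^ 2) m * q ^ (2 * (m + 1)) /
            (qpoch (- z * q / \<alpha>) q (2 * (m + 1)) * qpoch (z * q) q (2 * (m + 1)) *
             qpoch_inf (- z * q ^ (2 * (m + 1) + 2) / \<alpha>) (q ^ 2) *
             qpoch_inf (z * q ^ (2 * (m + 1) + 2)) (q ^ 2)))
         = q ^ 2 * qpoch_inf (z ^ 2 * q ^ 2 / \<alpha>) (q ^ 2) /
             (qpoch_inf (z * q) q * qpoch_inf (- z * q / \<alpha>) q) * omega1 \<alpha> z q
           + F_rem \<alpha> z q"
proof -
  define p where "p = q ^ 2"
  define x where "x = z * q"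
  define y where "y = z * q / \<alpha>"
  have q: "norm q < 1" and p: "norm p < 1" and x: "norm x < 1" "norm (- x) < 1"
    using assms(4,5) by (simp_all add: p_def x_def norm_power2_less_1)
  have y0: "y \<noteq> 0" "- y \<noteq> 0" using assms(1-3) by (simp_all add: y_def)
  have my_q: "- y * q ^ k \<noteq> 1" for k
    using assms(6)[of "Suc k"] assms(2) by (auto simp: y_def field_simps)
  have y_p: "y * p ^ k \<noteq> 1" for k
    using assms(7)[of k] assms(2) by (auto simp: y_def p_def power_mult[symmetric] field_simps)
  have my_p: "- y * p ^ k \<noteq> 1" and myq_p: "- y * q * p ^ k \<noteq> 1" for k
    using my_q[of "2 * k"] my_q[of "Suc (2 * k)"]
    by (simp_all add: p_def power_mult[symmetric] mult.assoc)
  have xq: "norm (x * q) < 1"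
    using norm_mult_power_le[OF q, of x 1] x by simp
  have x_p: "x * p ^ k \<noteq> 1" and mx_p: "- x * p ^ k \<noteq> 1" and xq_p: "x * q * p ^ k \<noteq> 1" for k
    using mult_power_neq_1[OF p x(1)] mult_power_neq_1[OF p x(2)] mult_power_neq_1[OF p xq] by auto

  define D where "D = qpoch_inf (- y * q) p * qpoch_inf (x * q) p"
  define E where "E = qpoch_inf (x * y) p / (qpoch_inf x p * qpoch_inf (- y) p)"
  define T where "T = (\<Sum>N. \<Prod>k<N. x / y * p ^ Suc k)"
  define V where "V = (\<Sum>m. qpoch (p / y) p m * (- x) ^ m)"
  define G where "G = (\<Sum>m. qpoch (- p / y) p m * x ^ m / qpoch (- x) p (Suc m))"
  define L where "L = (\<lambda>n. qpoch (x * y) p n * p ^ n / (qpoch (- y) p (Suc n) * qpoch x p (Suc n)))"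
  define W where "W = (\<Sum>n. p ^ n / (qpoch y p (Suc n) * qpoch (- x) p (Suc n)))"

  have D0: "D \<noteq> 0"
    unfolding D_def using qpoch_inf_nonzero[OF p] myq_p xq_p by auto
  have nz: "qpoch_inf x p \<noteq> 0" "qpoch_inf (- x) p \<noteq> 0" "qpoch_inf y p \<noteq> 0" "qpoch_inf (- y) p \<noteq> 0"
    by (intro qpoch_inf_nonzero[OF p] x_p mx_p y_p my_p)+

  have L: "L sums (- (E * V / y) + 1 / y * G)"
  proof -
    \<comment> \<open>With \<open>u = -x\<close> a factor \<open>-x\<close> splits off and the product is a shifted factorial.\<close>
    have "(\<Prod>k<N. - x - x * p / - y * p ^ k) = qpoch (p / y) p N * (- x) ^ N" for N
      by (induction N) (simp_all add: qpoch_Suc algebra_simps)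
    with three_term_transformation[OF p x(1) x(2) y0(2) my_p] show ?thesis
      unfolding L_def G_def V_def E_def by (simp add: ac_simps)
  qed
  have W: "W = T / (y * qpoch_inf y p * qpoch_inf (- x) p) - 1 / y * V"
  proof -
    have "qpoch 0 p n = 1" "qpoch_inf 0 p = 1" for n by (simp_all add: qpoch_def qpoch_inf_def)
    with three_term_transformation[OF p x(2) _ y0(1) y_p, of 0] show ?thesis
      unfolding W_def V_def T_def by (simp add: sums_iff ac_simps)
  qed

  have "(\<Sum>m. qpoch (z ^ 2 * q ^ 2 / \<alpha>) (q ^ 2) m * q ^ (2 * (m + 1)) /
            (qpoch (- z * q / \<alpha>) q (2 * (m + 1)) * qpoch (z * q) q (2 * (m + 1)) *
             qpoch_inf (- z * q ^ (2 * (m + 1) + 2) / \<alpha>) (q ^ 2) *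
             qpoch_inf (z * q ^ (2 * (m + 1) + 2)) (q ^ 2))) = (\<Sum>m. p / D * L m)"
  proof (rule suminf_cong)
    fix m :: nat
    have args: "z ^ 2 * q ^ 2 / \<alpha> = x * y" "- z * q / \<alpha> = - y" "z * q = x"
      "- z * q ^ (2 * (m + 1) + 2) / \<alpha> = - y * q * p ^ Suc m"
      "z * q ^ (2 * (m + 1) + 2) = x * q * p ^ Suc m" "q ^ (2 * (m + 1)) = p * p ^ m"
      by (simp_all add: x_def y_def p_def power2_eq_square power_mult power_mult_distrib)
    have D: "D = qpoch (- y * q) p (Suc m) * qpoch_inf (- y * q * p ^ Suc m) p *
        (qpoch (x * q) p (Suc m) * qpoch_inf (x * q * p ^ Suc m) p)"
      unfolding D_def by (simp only: qpoch_inf_split[OF p, of _ "Suc m", symmetric])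
    show "qpoch (z ^ 2 * q ^ 2 / \<alpha>) (q ^ 2) m * q ^ (2 * (m + 1)) /
            (qpoch (- z * q / \<alpha>) q (2 * (m + 1)) * qpoch (z * q) q (2 * (m + 1)) *
             qpoch_inf (- z * q ^ (2 * (m + 1) + 2) / \<alpha>) (q ^ 2) *
             qpoch_inf (z * q ^ (2 * (m + 1) + 2)) (q ^ 2)) = p / D * L m"
      unfolding args qpoch_even unfolding p_def[symmetric] D L_def
      by (simp add: ac_simps)
  qed
  also have "\<dots> = p / D * (- (E * V / y) + 1 / y * G)"
    using sums_mult[OF L] by (rule sums_unique[symmetric])
  finally have lhs: "(\<Sum>m. qpoch (z ^ 2 * q ^ 2 / \<alpha>) (q ^ 2) m * q ^ (2 * (m + 1)) /
            (qpoch (- z * q / \<alpha>) q (2 * (m + 1)) * qpoch (z * q) q (2 * (m + 1)) *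
             qpoch_inf (- z * q ^ (2 * (m + 1) + 2) / \<alpha>) (q ^ 2) *
             qpoch_inf (z * q ^ (2 * (m + 1) + 2)) (q ^ 2))) =
          p / D * (- (E * V / y) + 1 / y * G)" .

  have omega: "omega1 \<alpha> z q = W"
    unfolding omega1_def W_def by (simp add: x_def y_def p_def power_mult[symmetric] mult.commute)

  have prefactor: "q ^ 2 * qpoch_inf (z ^ 2 * q ^ 2 / \<alpha>) (q ^ 2) /
      (qpoch_inf (z * q) q * qpoch_inf (- z * q / \<alpha>) q) = p / D * E"
  proof -
    have "z ^ 2 * q ^ 2 / \<alpha> = x * y" "- z * q / \<alpha> = - y" "z * q = x"
      by (simp_all add: x_def y_def power2_eq_square)
    thus ?thesis
      unfolding qpoch_inf_even_odd[OF q, of "z * q"] qpoch_inf_even_odd[OF q, of "- z * q / \<alpha>"]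
      by (simp add: D_def E_def p_def ac_simps)
  qed

  have rem: "F_rem \<alpha> z q =
    1 / D * (p / y * G - p / y * (qpoch_inf (x * y) p /
       (qpoch_inf x p * qpoch_inf (- x) p * (qpoch_inf y p * qpoch_inf (- y) p))) * T)"
  proof -
    have "1 + y \<noteq> 0" using my_p[of 0] by (auto simp: add_eq_0_iff)
    \<comment> \<open>The extra first factor \<open>1 + 1 / y\<close> is what cancels the prefactor \<open>1 / (1 + y)\<close>.\<close>
    have "qpoch (- (1 / y)) p (Suc m) = (1 + y) / y * qpoch (- p / y) p m" for m
      using y0 unfolding qpoch_Suc_left by (simp add: field_simps)
    hence "(\<Sum>m. qpoch (- (1 / y)) p (Suc m) / qpoch (- x) p (Suc m) * x ^ m) =
        (\<Sum>m. (1 + y) / y * (qpoch (- p / y) p m * x ^ m / qpoch (- x) p (Suc m)))"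
      by (simp add: ac_simps)
    also have "\<dots> = (1 + y) / y * G"
      unfolding G_def by (rule suminf_mult[OF Fine_series_summable[OF p x]])
    finally have G: "p / (1 + y) * (\<Sum>m. qpoch (- (1 / y)) p (Suc m) / qpoch (- x) p (Suc m) * x ^ m)
        = p / y * G"
      using \<open>1 + y \<noteq> 0\<close> by simp
    have T: "(\<Sum>n. \<alpha> ^ n * q ^ (n ^ 2 + n)) = T"
      unfolding T_def
    proof (rule suminf_cong)
      fix n
      have "x / y = \<alpha>" using assms by (simp add: x_def y_def)
      show "\<alpha> ^ n * q ^ (n ^ 2 + n) = (\<Prod>k<n. x / y * p ^ Suc k)"
        unfolding \<open>x / y = \<alpha>\<close>
      proof (induction n)
        case (Suc n)
        have "(Suc n) ^ 2 + Suc n = n ^ 2 + n + 2 * Suc n" by (simp add: power2_eq_square)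
        hence "q ^ ((Suc n) ^ 2 + Suc n) = q ^ (n ^ 2 + n) * p ^ Suc n"
          by (simp only: power_add power_mult p_def)
        thus ?case using Suc.IH by (simp add: ac_simps)
      qed simp
    qed
    have squares: "qpoch_inf (z ^ 2 * q ^ 2) (q ^ 4) = qpoch_inf x p * qpoch_inf (- x) p"
      "qpoch_inf (z ^ 2 * q ^ 2 / \<alpha> ^ 2) (q ^ 4) = qpoch_inf y p * qpoch_inf (- y) p"
      using qpoch_inf_difference_of_squares[OF p, of x] qpoch_inf_difference_of_squares[OF p, of y]
      by (simp_all add: p_def x_def y_def power_mult_distrib power_divide power_mult[symmetric])
    have args: "- z * q ^ 2 / \<alpha> = - y * q" "z * q ^ 2 = x * q" "z * q / \<alpha> = y"
      "- \<alpha> / (z * q) = - (1 / y)" "- z * q = - x" "\<alpha> * q / z = p / y" "z ^ 2 * q ^ 2 / \<alpha> = x * y"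
      using assms by (simp_all add: x_def y_def p_def power2_eq_square)
    show ?thesis
      unfolding F_rem_def squares T args unfolding p_def[symmetric] x_def[symmetric] D_def[symmetric]
      using G by simp
  qed

  show ?thesis
    unfolding lhs prefactor omega rem W E_def
    using D0 nz y0 by (simp add: field_simps)
qed

end
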